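(* Let $(\mathfrak g,[\cdot,\cdot],B)$ be a quadratic Lie algebra over $\mathbb K$ and let $\alpha$ be an automorphism of the Lie algebra $\mathfrak g$ that is symmetric with respect to $B$, i.e. $B(\alpha(x),y)=B(x,\alpha(y))$ for all $x,y\in\mathfrak g$. For $x,y\in\mathfrak g$ set $$[x,y]_\alpha=[\alpha(x),\alpha(y)],\qquad B_\alpha(x,y)=B(\alpha(x),y).$$ Then $(\mathfrak g,[\cdot,\cdot]_\alpha,\alpha,B_\alpha)$ is a quadratic Hom-Lie algebra.
   Context: $\mathbb K$ is an algebraically closed field of characteristic $0$. A quadratic Lie algebra $(\mathfrak g,[\cdot,\cdot],B)$ is a Lie algebra with a symmetric nondegenerate bilinear form $B$ satisfying $B([x,y],z)=B(x,[y,z])$. A Hom-Lie algebra is a triple $(\mathfrak g,[\cdot,\cdot],\alpha)$ with $[\cdot,\cdot]$ a skew-symmetric bilinear bracket and $\alpha$ a linear map such that $[\alpha(x),[y,z]]+[\alpha(y),[z,x]]+[\alpha(z),[x,y]]=0$ for all $x,y,z$. It is quadratic with form $B$ if $B$ is a symmetric nondegenerate bilinear form with $B([x,y],z)=B(x,[y,z])$ and $B(\alpha(x),y)=B(x,\alpha(y))$. *)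

theory Defs
  imports "HOL-Computational_Algebra.Polynomial"
begin

text \<open>
  A vector space over a field \<open>'k\<close> is given by the scalar multiplication \<open>scale\<close> on an
  additive group \<open>'v\<close>; no finiteness of the dimension is assumed.
\<close>

locale bilinear_map = vector_space scale + target: vector_space scale'
  for scale :: "'k::field \<Rightarrow> 'v::ab_group_add \<Rightarrow> 'v"
    and scale' :: "'k \<Rightarrow> 'w::ab_group_add \<Rightarrow> 'w"
    and f :: "'v \<Rightarrow> 'v \<Rightarrow> 'w" +
  assumes linear_left: "Vector_Spaces.linear scale scale' (\<lambda>x. f x y)"
    and linear_right: "Vector_Spaces.linear scale scale' (\<lambda>y. f x y)"

locale lie_algebra = bilinear_map scale scale br
  for scale :: "'k::field \<Rightarrow> 'v::ab_group_add \<Rightarrow> 'v"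
    and br :: "'v \<Rightarrow> 'v \<Rightarrow> 'v" +
  assumes alternating: "br x x = 0"
    and jacobi: "br x (br y z) + br y (br z x) + br z (br x y) = 0"

locale symmetric_nondegenerate_form = bilinear_map scale "(*)" B
  for scale :: "'k::field \<Rightarrow> 'v::ab_group_add \<Rightarrow> 'v"
    and B :: "'v \<Rightarrow> 'v \<Rightarrow> 'k" +
  assumes symmetric: "B x y = B y x"
    and nondegenerate: "(\<And>y. B x y = 0) \<Longrightarrow> x = 0"

locale quadratic_lie_algebra =
  lie_algebra scale br + form: symmetric_nondegenerate_form scale B
  for scale :: "'k::field \<Rightarrow> 'v::ab_group_add \<Rightarrow> 'v"
    and br :: "'v \<Rightarrow> 'v \<Rightarrow> 'v"
    and B :: "'v \<Rightarrow> 'v \<Rightarrow> 'k" +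
  assumes invariant: "B (br x y) z = B x (br y z)"

locale lie_automorphism =
  lie_algebra scale br + Vector_Spaces.linear scale scale \<alpha>
  for scale :: "'k::field \<Rightarrow> 'v::ab_group_add \<Rightarrow> 'v"
    and br :: "'v \<Rightarrow> 'v \<Rightarrow> 'v"
    and \<alpha> :: "'v \<Rightarrow> 'v" +
  assumes bij: "bij \<alpha>"
    and bracket_preserving: "\<alpha> (br x y) = br (\<alpha> x) (\<alpha> y)"

text \<open>The twist map \<open>\<alpha>\<close> is not required to preserve the bracket.\<close>

locale hom_lie_algebra =
  bilinear_map scale scale br + Vector_Spaces.linear scale scale \<alpha>
  for scale :: "'k::field \<Rightarrow> 'v::ab_group_add \<Rightarrow> 'v"
    and br :: "'v \<Rightarrow> 'v \<Rightarrow> 'v"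
    and \<alpha> :: "'v \<Rightarrow> 'v" +
  assumes skew_symmetric: "br x y = - br y x"
    and hom_jacobi: "br (\<alpha> x) (br y z) + br (\<alpha> y) (br z x) + br (\<alpha> z) (br x y) = 0"

locale quadratic_hom_lie_algebra =
  hom_lie_algebra scale br \<alpha> + form: symmetric_nondegenerate_form scale B
  for scale :: "'k::field \<Rightarrow> 'v::ab_group_add \<Rightarrow> 'v"
    and br :: "'v \<Rightarrow> 'v \<Rightarrow> 'v"
    and \<alpha> :: "'v \<Rightarrow> 'v"
    and B :: "'v \<Rightarrow> 'v \<Rightarrow> 'k" +
  assumes invariant: "B (br x y) z = B x (br y z)"
    and twist_symmetric: "B (\<alpha> x) y = B x (\<alpha> y)"

definition twisted_bracket :: "('v \<Rightarrow> 'v) \<Rightarrow> ('v \<Rightarrow> 'v \<Rightarrow> 'v) \<Rightarrow> 'v \<Rightarrow> 'v \<Rightarrow> 'v"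
  where "twisted_bracket \<alpha> br x y = br (\<alpha> x) (\<alpha> y)"

definition twisted_form :: "('v \<Rightarrow> 'v) \<Rightarrow> ('v \<Rightarrow> 'v \<Rightarrow> 'k) \<Rightarrow> 'v \<Rightarrow> 'v \<Rightarrow> 'k"
  where "twisted_form \<alpha> B x y = B (\<alpha> x) y"

end

theory Submission
  imports Defs
begin

text \<open>Since \<alpha> preserves the bracket, one factor of \<alpha> can be pulled out of each
  term of the Hom-Jacobi sum, and what remains is the Jacobi identity at \<alpha> x, \<alpha> y,
  \<alpha> z (\<open>hom_lie_algebra_twisted_bracket\<close>). On the side of the form,
  self-adjointness of \<alpha> gives symmetry and injectivity gives nondegeneracy
  (\<open>symmetric_nondegenerate_form_twisted_form\<close>). Invariance and the symmetry of the
  twist then come from moving \<alpha> across \<open>B\<close>.\<close>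

lemma bilinear_map_compose_left:
  assumes "bilinear_map s s' f" and "Vector_Spaces.linear s s g"
  shows "bilinear_map s s' (\<lambda>x y. f (g x) y)"
proof -
  interpret bilinear_map s s' f by fact
  show ?thesis
    using Vector_Spaces.linear_compose[OF assms(2) linear_left] linear_right
    by (intro bilinear_map.intro bilinear_map_axioms.intro)
      (simp_all add: o_def vector_space_axioms target.vector_space_axioms)
qed

lemma bilinear_map_compose_right:
  assumes "bilinear_map s s' f" and "Vector_Spaces.linear s s g"
  shows "bilinear_map s s' (\<lambda>x y. f x (g y))"
proof -
  interpret bilinear_map s s' f by fact
  show ?thesis
    using Vector_Spaces.linear_compose[OF assms(2) linear_right] linear_left
    by (intro bilinear_map.intro bilinear_map_axioms.intro)
      (simp_all add: o_def vector_space_axioms target.vector_space_axioms)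
qed

text \<open>Polarization: expand \<open>br (x + y) (x + y) = 0\<close>. This bridges the alternating
  axiom of Lie algebras and the skew-symmetry axiom of Hom-Lie algebras.\<close>

lemma (in lie_algebra) bracket_skew_symmetric: "br x y = - br y x"
proof -
  have "br (x + y) (x + y) = br x (x + y) + br y (x + y)"
    using Vector_Spaces.linear.axioms(3)[OF linear_left] by (rule module_hom.add)
  also have "\<dots> = (br x x + br x y) + (br y x + br y y)"
    by (simp add: module_hom.add[OF Vector_Spaces.linear.axioms(3)[OF linear_right]])
  finally show ?thesis
    by (simp add: alternating eq_neg_iff_add_eq_0)
qed

lemma (in lie_automorphism) hom_lie_algebra_twisted_bracket:
  "hom_lie_algebra scale (twisted_bracket \<alpha> br) \<alpha>"
proof -
  have "bilinear_map scale scale (twisted_bracket \<alpha> br)"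
    unfolding twisted_bracket_def
    using bilinear_map_compose_right[OF bilinear_map_compose_left[OF
      bilinear_map_axioms linear_axioms] linear_axioms] .
  then interpret twisted: bilinear_map scale scale "twisted_bracket \<alpha> br" .
  show ?thesis
  proof
    show "twisted_bracket \<alpha> br x y = - twisted_bracket \<alpha> br y x" for x y
      unfolding twisted_bracket_def by (rule bracket_skew_symmetric)
    fix x y z
    \<comment> \<open>Pushing the outer \<alpha> through the sum and the brackets turns this into
      the Hom-Jacobi sum.\<close>
    have "\<alpha> (br (\<alpha> x) (br (\<alpha> y) (\<alpha> z)) + br (\<alpha> y) (br (\<alpha> z) (\<alpha> x))
        + br (\<alpha> z) (br (\<alpha> x) (\<alpha> y))) = 0"
      by (simp only: jacobi zero)
    then show "twisted_bracket \<alpha> br (\<alpha> x) (twisted_bracket \<alpha> br y z)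
        + twisted_bracket \<alpha> br (\<alpha> y) (twisted_bracket \<alpha> br z x)
        + twisted_bracket \<alpha> br (\<alpha> z) (twisted_bracket \<alpha> br x y) = 0"
      by (simp add: twisted_bracket_def add bracket_preserving)
  qed
qed

text \<open>Symmetry is the chain B(\<alpha> x, y) = B(x, \<alpha> y) = B(\<alpha> y, x). If x lies
  in the radical of the twisted form, then \<alpha> x lies in the radical of \<open>B\<close>, so
  \<alpha> x = 0 and injectivity gives x = 0.\<close>

lemma symmetric_nondegenerate_form_twisted_form:
  assumes "symmetric_nondegenerate_form scale B"
    and lin: "Vector_Spaces.linear scale scale \<alpha>" and "inj \<alpha>"
    and self_adjoint: "\<And>x y. B (\<alpha> x) y = B x (\<alpha> y)"
  shows "symmetric_nondegenerate_form scale (twisted_form \<alpha> B)"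
proof -
  interpret symmetric_nondegenerate_form scale B by fact
  interpret \<alpha>: Vector_Spaces.linear scale scale \<alpha> by fact
  have "bilinear_map scale (*) (twisted_form \<alpha> B)"
    unfolding twisted_form_def
    using bilinear_map_axioms lin by (rule bilinear_map_compose_left)
  then interpret twisted: bilinear_map scale "(*)" "twisted_form \<alpha> B" .
  show ?thesis
  proof
    show "twisted_form \<alpha> B x y = twisted_form \<alpha> B y x" for x y
      unfolding twisted_form_def by (metis self_adjoint symmetric)
    show "x = 0" if "\<And>y. twisted_form \<alpha> B x y = 0" for x
    proof -
      have "\<alpha> x = 0"
        using that by (intro nondegenerate) (simp add: twisted_form_def)
      then show ?thesis
        using \<open>inj \<alpha>\<close> by (metis \<alpha>.zero injD)
    qed
  qed
qed

theorem proposition4p1: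
  fixes scale :: "'k::{alg_closed_field, field_char_0} \<Rightarrow> 'v::ab_group_add \<Rightarrow> 'v"
    and br :: "'v \<Rightarrow> 'v \<Rightarrow> 'v"
    and B :: "'v \<Rightarrow> 'v \<Rightarrow> 'k"
    and \<alpha> :: "'v \<Rightarrow> 'v"
  assumes "quadratic_lie_algebra scale br B"
    and "lie_automorphism scale br \<alpha>"
    and "\<And>x y. B (\<alpha> x) y = B x (\<alpha> y)"
  shows "quadratic_hom_lie_algebra scale
           (twisted_bracket \<alpha> br) \<alpha> (twisted_form \<alpha> B)"
proof -
  interpret quadratic_lie_algebra scale br B by fact
  interpret \<alpha>: lie_automorphism scale br \<alpha> by fact
  interpret twisted: hom_lie_algebra scale "twisted_bracket \<alpha> br" \<alpha>
    by (rule \<alpha>.hom_lie_algebra_twisted_bracket)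
  interpret twisted_form: symmetric_nondegenerate_form scale "twisted_form \<alpha> B"
    using form.symmetric_nondegenerate_form_axioms \<alpha>.linear_axioms bij_is_inj[OF \<alpha>.bij] assms(3)
    by (rule symmetric_nondegenerate_form_twisted_form)
  show ?thesis
    \<comment> \<open>With u, v, w the images of x, y, z under \<alpha>, invariance reads B(\<alpha>
      [u,v], z) = B([u,v], w) = B(u, [v,w]). Symmetry of the twist is B(\<alpha> u, y) = B(u,
      v).\<close>
    by unfold_locales (simp_all add: twisted_bracket_def twisted_form_def assms(3) invariant)
qed

end
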